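(* Let $G$ be a finite nonabelian group and let $\psi\in\mathrm{Ab}(G)$ be an endomorphism of $G$ with abelian image. Then for all integers $m,n\ge 0$, the triple $(G,\circ_m,\circ_n)$ is a brace (i.e., a skew left brace), where $g\circ_n h=g\,\psi_n(g^{-1})\,h\,\psi_n(g)$ for $g,h\in G$ and $\psi_n=-(1-\psi)^n+1$.
   Context: $G$ is written multiplicatively, with identity $1_G$. $\mathrm{Ab}(G)$ is the set of abelian maps, i.e., group endomorphisms $\psi:G\to G$ whose image $\psi(G)$ is abelian. $\mathrm{Map}(G)$ is the set of all functions $G\to G$, with operations $(\phi+\chi)(g)=\phi(g)\chi(g)$, $(-\phi)(g)=\phi(g)^{-1}$, $\phi-\chi=\phi+(-\chi)$, and product $(\phi\chi)(g)=\phi(\chi(g))$; $1$ denotes the identity map, $0$ the trivial map $g\mapsto 1_G$, and $\phi^n$ the $n$-fold composite ($\phi^0=1$). For $\psi\in\mathrm{Ab}(G)$ and $n\ge 0$, $\psi_n=-(1-\psi)^n+1\in\mathrm{Map}(G)$, i.e. $\psi_n(g)=\big((1-\psi)^n(g)\big)^{-1}g$, where $(1-\psi)(g)=g\psi(g)^{-1}$. A brace (skew left brace) is a triple $(B,\cdot,\circ)$ where $(B,\cdot)$ and $(B,\circ)$ are groups on the same set $B$ such that $x\circ(y\cdot z)=(x\circ y)\cdot x^{-1}\cdot(x\circ z)$ for all $x,y,z\in B$, where $x^{-1}$ is the inverse of $x$ in $(B,\cdot)$. (In $(G,\circ_m,\circ_n)$ the operation $\circ_m$ plays the role of $\cdot$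 and $\circ_n$ the role of $\circ$.) *)

theory Defs
  imports "HOL-Algebra.Algebra"
begin

text \<open>A skew left brace is given by two group structures on one set: \<open>A\<close> is the
  dot structure and \<open>C\<close> the circle structure.\<close>

locale skew_left_brace = dot: group A + circ: group C
  for A :: "('a, 'b) monoid_scheme" and C :: "('a, 'c) monoid_scheme" +
  assumes carrier_eq: "carrier C = carrier A"
    and brace_relation:
      "\<lbrakk>x \<in> carrier A; y \<in> carrier A; z \<in> carrier A\<rbrakk> \<Longrightarrow>
        x \<otimes>\<^bsub>C\<^esub> (y \<otimes>\<^bsub>A\<^esub> z) =
          (x \<otimes>\<^bsub>C\<^esub> y) \<otimes>\<^bsub>A\<^esub> inv\<^bsub>A\<^esub> x \<otimes>\<^bsub>A\<^esub> (x \<otimes>\<^bsub>C\<^esub> z)"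

text \<open>As usual for \<^const>\<open>hom\<close>, the values of maps outside the carrier are irrelevant.\<close>

definition abelian_maps :: "('a, 'b) monoid_scheme \<Rightarrow> ('a \<Rightarrow> 'a) set" where
  "abelian_maps G = {\<psi> \<in> hom G G. comm_group (G\<lparr>carrier := \<psi> ` carrier G\<rparr>)}"

definition map_add :: "('a, 'b) monoid_scheme \<Rightarrow> ('a \<Rightarrow> 'a) \<Rightarrow> ('a \<Rightarrow> 'a) \<Rightarrow> 'a \<Rightarrow> 'a" where
  "map_add G \<phi> \<chi> = (\<lambda>g. \<phi> g \<otimes>\<^bsub>G\<^esub> \<chi> g)"

definition map_uminus :: "('a, 'b) monoid_scheme \<Rightarrow> ('a \<Rightarrow> 'a) \<Rightarrow> 'a \<Rightarrow> 'a" where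
  "map_uminus G \<phi> = (\<lambda>g. inv\<^bsub>G\<^esub> (\<phi> g))"

definition map_minus :: "('a, 'b) monoid_scheme \<Rightarrow> ('a \<Rightarrow> 'a) \<Rightarrow> ('a \<Rightarrow> 'a) \<Rightarrow> 'a \<Rightarrow> 'a" where
  "map_minus G \<phi> \<chi> = map_add G \<phi> (map_uminus G \<chi>)"

text \<open>\<open>\<psi>\<^sub>n = -(1 - \<psi>)\<^sup>n + 1\<close>, where the power is the \<open>n\<close>-fold composite.\<close>

definition psi_iter :: "('a, 'b) monoid_scheme \<Rightarrow> ('a \<Rightarrow> 'a) \<Rightarrow> nat \<Rightarrow> 'a \<Rightarrow> 'a" where
  "psi_iter G \<psi> n = map_add G (map_uminus G ((map_minus G id \<psi>) ^^ n)) id"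

definition circ_op :: "('a, 'b) monoid_scheme \<Rightarrow> ('a \<Rightarrow> 'a) \<Rightarrow> nat \<Rightarrow> 'a \<Rightarrow> 'a \<Rightarrow> 'a" where
  "circ_op G \<psi> n g h =
    g \<otimes>\<^bsub>G\<^esub> psi_iter G \<psi> n (inv\<^bsub>G\<^esub> g) \<otimes>\<^bsub>G\<^esub> h \<otimes>\<^bsub>G\<^esub> psi_iter G \<psi> n g"

text \<open>The record has to name the identity of \<open>(G, \<circ>\<^sub>n)\<close>. Naming \<open>\<one>\<close> loses no generality:
  \<open>\<psi>\<^sub>n(\<one>) = \<one>\<close> gives \<open>\<one> \<circ>\<^sub>n h = h\<close>, so \<open>\<one>\<close> is the only possible identity.\<close>

definition circ_group :: "('a, 'b) monoid_scheme \<Rightarrow> ('a \<Rightarrow> 'a) \<Rightarrow> nat \<Rightarrow> 'a monoid" where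
  "circ_group G \<psi> n = \<lparr>carrier = carrier G, monoid.mult = circ_op G \<psi> n, one = \<one>\<^bsub>G\<^esub>\<rparr>"

end

theory Submission imports Defs begin

text \<open>From \<open>\<psi>\<^sub>n\<^sub>+\<^sub>1(g) = \<psi>(g) \<psi>(\<psi>\<^sub>n(g))\<^sup>-\<^sup>1 \<psi>\<^sub>n(g)\<close> each \<open>\<psi>\<^sub>n\<close> is, by induction, a
  homomorphism into the abelian subgroup \<open>\<psi>(G)\<close>: a product of homomorphisms with commuting
  values is a homomorphism. Hence all values of \<open>\<psi>\<^sub>m\<close> and \<open>\<psi>\<^sub>n\<close> commute with each other, and for
  any two homomorphisms with this property the conjugation-twisted operations
  \<open>g \<phi>(g)\<^sup>-\<^sup>1 h \<phi>(g)\<close> form a brace, because \<open>\<phi>(g \<circ> h) = \<phi>(g) \<phi>(h)\<close> for either twist.\<close>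

section \<open>Operations twisted by conjugation\<close>

definition twisted_group :: "('a, 'b) monoid_scheme \<Rightarrow> ('a \<Rightarrow> 'a) \<Rightarrow> 'a monoid" where
  "twisted_group G \<phi> = \<lparr>carrier = carrier G,
     monoid.mult = (\<lambda>g h. g \<otimes>\<^bsub>G\<^esub> \<phi> (inv\<^bsub>G\<^esub> g) \<otimes>\<^bsub>G\<^esub> h \<otimes>\<^bsub>G\<^esub> \<phi> g), one = \<one>\<^bsub>G\<^esub>\<rparr>"

text \<open>Unfolding suffices because \<open>twisted_group\<close> is written with
  \<open>\<phi> (inv g)\<close>. The form \<open>inv (\<phi> g)\<close>, better suited to
  calculation, comes from \<open>mult_twisted_group\<close> once \<phi> is a homomorphism.\<close>

lemma circ_group_eq_twisted_group: "circ_group G \<psi> n = twisted_group G (psi_iter G \<psi> n)"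
  by (simp add: circ_group_def twisted_group_def circ_op_def fun_eq_iff)

lemma carrier_twisted_group [simp]: "carrier (twisted_group G \<phi>) = carrier G"
  by (simp add: twisted_group_def)

lemma one_twisted_group [simp]: "\<one>\<^bsub>twisted_group G \<phi>\<^esub> = \<one>\<^bsub>G\<^esub>"
  by (simp add: twisted_group_def)

definition commuting_on :: "('a, 'b) monoid_scheme \<Rightarrow> ('a \<Rightarrow> 'a) \<Rightarrow> ('a \<Rightarrow> 'a) \<Rightarrow> bool" where
  "commuting_on G \<phi> \<chi> \<longleftrightarrow>
    (\<forall>x\<in>carrier G. \<forall>y\<in>carrier G. \<phi> x \<otimes>\<^bsub>G\<^esub> \<chi> y = \<chi> y \<otimes>\<^bsub>G\<^esub> \<phi> x)"

lemma commuting_onD: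
  "\<lbrakk>commuting_on G \<phi> \<chi>; x \<in> carrier G; y \<in> carrier G\<rbrakk> \<Longrightarrow> \<phi> x \<otimes>\<^bsub>G\<^esub> \<chi> y = \<chi> y \<otimes>\<^bsub>G\<^esub> \<phi> x"
  by (simp add: commuting_on_def)

context group
begin

lemma inv_cancel_left [simp]:
  "\<lbrakk>x \<in> carrier G; y \<in> carrier G\<rbrakk> \<Longrightarrow> inv x \<otimes> (x \<otimes> y) = y"
  "\<lbrakk>x \<in> carrier G; y \<in> carrier G\<rbrakk> \<Longrightarrow> x \<otimes> (inv x \<otimes> y) = y"
  by (simp_all flip: m_assoc)

lemma conjugate_eq_self:
  "\<lbrakk>x \<otimes> y = y \<otimes> x; x \<in> carrier G; y \<in> carrier G\<rbrakk> \<Longrightarrow> inv x \<otimes> (y \<otimes> x) = y"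
  by (metis inv_cancel_left(1))

lemma hom_inv:
  "\<lbrakk>\<phi> \<in> hom G G; x \<in> carrier G\<rbrakk> \<Longrightarrow> \<phi> (inv x) = inv (\<phi> x)"
  using group_hom.hom_inv[of G G \<phi> x] is_group
  by (simp add: group_hom_def group_hom_axioms_def)

lemma mult_twisted_group:
  assumes "\<phi> \<in> hom G G" "x \<in> carrier G" "y \<in> carrier G"
  shows "x \<otimes>\<^bsub>twisted_group G \<phi>\<^esub> y = x \<otimes> inv (\<phi> x) \<otimes> y \<otimes> \<phi> x"
  using assms by (simp add: twisted_group_def hom_inv)

text \<open>Applying \<phi> turns conjugation by \<open>\<chi> x\<close> into conjugation by
  \<open>\<phi> (\<chi> x)\<close>, which fixes \<open>\<phi> y\<close> because both are values of
  \<phi>. The twist \<chi> may differ from \<phi>, as the brace relation evaluates \<phi> on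
  products of the other group.\<close>

lemma hom_mult_twisted_group:
  assumes "\<phi> \<in> hom G G" "\<chi> \<in> hom G G" "commuting_on G \<phi> \<phi>"
    and x: "x \<in> carrier G" and y: "y \<in> carrier G"
  shows "\<phi> (x \<otimes>\<^bsub>twisted_group G \<chi>\<^esub> y) = \<phi> x \<otimes> \<phi> y"
proof -
  have [simp]: "\<phi> z \<in> carrier G" "\<chi> z \<in> carrier G" if "z \<in> carrier G" for z
    using assms(1,2) that by (auto simp: hom_def)
  have "\<phi> (x \<otimes>\<^bsub>twisted_group G \<chi>\<^esub> y) = \<phi> x \<otimes> (inv (\<phi> (\<chi> x)) \<otimes> (\<phi> y \<otimes> \<phi> (\<chi> x)))"
    using x y assms(1,2) by (simp add: mult_twisted_group hom_mult hom_inv m_assoc)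
  also have "inv (\<phi> (\<chi> x)) \<otimes> (\<phi> y \<otimes> \<phi> (\<chi> x)) = \<phi> y"
    using x y assms(3) by (simp add: conjugate_eq_self commuting_onD)
  finally show ?thesis .
qed

lemma mult_twisted_group_closed:
  assumes "\<phi> \<in> hom G G" "x \<in> carrier G" "y \<in> carrier G"
  shows "x \<otimes>\<^bsub>twisted_group G \<phi>\<^esub> y \<in> carrier G"
  using assms by (simp add: mult_twisted_group hom_in_carrier)

section \<open>Twisted groups and the brace relation\<close>

context
  fixes \<phi>
  assumes hom: "\<phi> \<in> hom G G" and comm: "commuting_on G \<phi> \<phi>"
begin

text \<open>A left inverse y of x must satisfy \<open>\<phi> y = inv (\<phi> x)\<close>, since
  \<phi> is multiplicative for the twisted product. The equation then reads \<open>y \<otimes>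
  \<phi> x \<otimes> x \<otimes> inv (\<phi> x) = \<one>\<close>, which determines y.\<close>

lemma twisted_group_inverse:
  assumes "x \<in> carrier G"
  shows "(\<phi> x \<otimes> inv x \<otimes> inv (\<phi> x)) \<otimes>\<^bsub>twisted_group G \<phi>\<^esub> x = \<one>"
proof -
  have [simp]: "\<phi> z \<in> carrier G" if "z \<in> carrier G" for z
    using hom that by (rule hom_in_carrier)
  have "\<phi> (\<phi> x \<otimes> inv x \<otimes> inv (\<phi> x)) = \<phi> (\<phi> x) \<otimes> inv (\<phi> x) \<otimes> inv (\<phi> (\<phi> x))"
    using hom assms by (simp add: hom_mult hom_inv)
  also have "\<dots> = inv (\<phi> x)"
  proof -
    have "\<phi> (\<phi> x) \<otimes> \<phi> (inv x) = \<phi> (inv x) \<otimes> \<phi> (\<phi> x)"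
      using comm assms by (intro commuting_onD) auto
    then show ?thesis using hom assms by (simp add: hom_inv m_assoc)
  qed
  finally show ?thesis
    using hom assms by (simp add: mult_twisted_group m_assoc)
qed

lemma group_twisted_group: "group (twisted_group G \<phi>)"
proof (rule groupI)
  have [simp]: "\<phi> z \<in> carrier G" if "z \<in> carrier G" for z
    using hom that by (rule hom_in_carrier)
  show "x \<otimes>\<^bsub>twisted_group G \<phi>\<^esub> y \<in> carrier (twisted_group G \<phi>)"
    if "x \<in> carrier (twisted_group G \<phi>)" "y \<in> carrier (twisted_group G \<phi>)" for x y
    using that hom by (simp add: mult_twisted_group_closed)
  show "\<one>\<^bsub>twisted_group G \<phi>\<^esub> \<in> carrier (twisted_group G \<phi>)"
    by simp
  show "\<one>\<^bsub>twisted_group G \<phi>\<^esub> \<otimes>\<^bsub>twisted_group G \<phi>\<^esub> x = x"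
    if "x \<in> carrier (twisted_group G \<phi>)" for x
    using that hom by (simp add: mult_twisted_group hom_one)
  show "\<exists>y\<in>carrier (twisted_group G \<phi>). y \<otimes>\<^bsub>twisted_group G \<phi>\<^esub> x = \<one>\<^bsub>twisted_group G \<phi>\<^esub>"
    if "x \<in> carrier (twisted_group G \<phi>)" for x
    using that twisted_group_inverse[of x]
    by (intro bexI[of _ "\<phi> x \<otimes> inv x \<otimes> inv (\<phi> x)"]) auto
  show "x \<otimes>\<^bsub>twisted_group G \<phi>\<^esub> y \<otimes>\<^bsub>twisted_group G \<phi>\<^esub> z
      = x \<otimes>\<^bsub>twisted_group G \<phi>\<^esub> (y \<otimes>\<^bsub>twisted_group G \<phi>\<^esub> z)"
    if "x \<in> carrier (twisted_group G \<phi>)" "y \<in> carrier (twisted_group G \<phi>)"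
      "z \<in> carrier (twisted_group G \<phi>)" for x y z
  proof -
    have xyz: "x \<in> carrier G" "y \<in> carrier G" "z \<in> carrier G" using that by auto
    \<comment> \<open>With the factors in the order \<open>\<phi> y \<otimes> \<phi> x\<close>, the
      inverse starts with \<open>inv (\<phi> x)\<close>, which cancels the trailing
      \<open>\<phi> x\<close> of the product of x and y.\<close>
    have "x \<otimes>\<^bsub>twisted_group G \<phi>\<^esub> y \<otimes>\<^bsub>twisted_group G \<phi>\<^esub> z
        = x \<otimes>\<^bsub>twisted_group G \<phi>\<^esub> y \<otimes> inv (\<phi> y \<otimes> \<phi> x) \<otimes> z \<otimes> (\<phi> y \<otimes> \<phi> x)"
      using hom comm xyz
      by (simp add: mult_twisted_group[OF hom mult_twisted_group_closed[OF hom]]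
          hom_mult_twisted_group commuting_onD[OF comm, of x y])
    also have "\<dots> = x \<otimes>\<^bsub>twisted_group G \<phi>\<^esub> (y \<otimes>\<^bsub>twisted_group G \<phi>\<^esub> z)"
      using hom xyz
      by (simp add: mult_twisted_group m_assoc inv_mult_group)
    finally show ?thesis .
  qed
qed

lemma inv_twisted_group:
  assumes "x \<in> carrier G"
  shows "inv\<^bsub>twisted_group G \<phi>\<^esub> x = \<phi> x \<otimes> inv x \<otimes> inv (\<phi> x)"
  using assms hom
  by (intro group.inv_equality[OF group_twisted_group])
    (simp_all add: twisted_group_inverse hom_in_carrier)

end

text \<open>Once expanded in G, the two sides of the brace relation differ only in the order of
  \<open>\<chi> x\<close> and \<open>\<phi> y\<close> on either side of z, so commutation of values
  across the two maps settles it.\<close>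

lemma skew_left_brace_twisted_group:
  assumes hom: "\<phi> \<in> hom G G" "\<chi> \<in> hom G G"
    and comm: "commuting_on G \<phi> \<phi>" "commuting_on G \<chi> \<chi>" "commuting_on G \<phi> \<chi>"
  shows "skew_left_brace (twisted_group G \<phi>) (twisted_group G \<chi>)" (is "skew_left_brace ?A ?C")
proof -
  interpret A: group ?A using hom(1) comm(1) by (rule group_twisted_group)
  interpret C: group ?C using hom(2) comm(2) by (rule group_twisted_group)
  have [simp]: "\<phi> z \<in> carrier G" "\<chi> z \<in> carrier G" if "z \<in> carrier G" for z
    using hom that by (auto simp: hom_in_carrier)
  have "x \<otimes>\<^bsub>?C\<^esub> (y \<otimes>\<^bsub>?A\<^esub> z) = (x \<otimes>\<^bsub>?C\<^esub> y) \<otimes>\<^bsub>?A\<^esub> inv\<^bsub>?A\<^esub> x \<otimes>\<^bsub>?A\<^esub> (x \<otimes>\<^bsub>?C\<^esub> z)"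
    if x: "x \<in> carrier G" and y: "y \<in> carrier G" and z: "z \<in> carrier G" for x y z
  proof -
    let ?u = "x \<otimes>\<^bsub>?C\<^esub> y" and ?v = "x \<otimes>\<^bsub>?C\<^esub> z"
    have u: "?u \<in> carrier G" and v: "?v \<in> carrier G"
      using hom x y z by (simp_all add: mult_twisted_group_closed)
    have ix: "inv\<^bsub>?A\<^esub> x \<in> carrier G" using A.inv_closed[of x] x by simp
    have \<phi>u: "\<phi> ?u = \<phi> x \<otimes> \<phi> y"
      using hom comm x y by (simp add: hom_mult_twisted_group)
    \<comment> \<open>\<phi> is also a homomorphism from \<open>?A\<close> to G, so it carries the
      inverse of \<open>?A\<close> to the inverse of G.\<close>
    have \<phi>ix: "\<phi> (inv\<^bsub>?A\<^esub> x) = inv (\<phi> x)"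
    proof (rule inv_equality[symmetric])
      show "\<phi> (inv\<^bsub>?A\<^esub> x) \<otimes> \<phi> x = \<one>"
        using hom_mult_twisted_group[OF hom(1) hom(1) comm(1) ix x] A.l_inv[of x] x hom(1)
        by (simp add: hom_one)
    qed (use x ix in auto)
    have \<phi>w: "\<phi> (?u \<otimes>\<^bsub>?A\<^esub> inv\<^bsub>?A\<^esub> x) = \<phi> y"
    proof -
      have "\<phi> (?u \<otimes>\<^bsub>?A\<^esub> inv\<^bsub>?A\<^esub> x) = \<phi> x \<otimes> \<phi> y \<otimes> inv (\<phi> x)"
        using hom_mult_twisted_group[OF hom(1) hom(1) comm(1) u ix] by (simp add: \<phi>u \<phi>ix)
      also have "\<dots> = \<phi> y"
        using x y by (simp add: commuting_onD[OF comm(1) x y] m_assoc)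
      finally show ?thesis .
    qed
    have w: "?u \<otimes>\<^bsub>?A\<^esub> inv\<^bsub>?A\<^esub> x = ?u \<otimes> inv (\<phi> y) \<otimes> inv x \<otimes> \<phi> y"
    proof -
      have "?u \<otimes>\<^bsub>?A\<^esub> inv\<^bsub>?A\<^esub> x
          = ?u \<otimes> inv (\<phi> x \<otimes> \<phi> y) \<otimes> (\<phi> x \<otimes> inv x \<otimes> inv (\<phi> x)) \<otimes> (\<phi> x \<otimes> \<phi> y)"
        using mult_twisted_group[OF hom(1) u ix] x
        by (simp add: \<phi>u inv_twisted_group[OF hom(1) comm(1)])
      then show ?thesis using u x y by (simp add: inv_mult_group m_assoc)
    qed
    have "?u \<otimes>\<^bsub>?A\<^esub> inv\<^bsub>?A\<^esub> x \<otimes>\<^bsub>?A\<^esub> ?v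
        = ?u \<otimes> inv (\<phi> y) \<otimes> inv x \<otimes> \<phi> y \<otimes> inv (\<phi> y) \<otimes> ?v \<otimes> \<phi> y"
      using mult_twisted_group[OF hom(1) mult_twisted_group_closed[OF hom(1) u ix] v]
      \<comment> \<open>Two passes: \<open>w\<close> would rewrite the argument of \<phi> and so
        hide the left-hand side of \<open>\<phi>w\<close>.\<close>
      by (simp add: \<phi>w) (simp add: w)
    also have "\<dots> = x \<otimes> inv (\<chi> x) \<otimes> y \<otimes> (\<chi> x \<otimes> inv (\<chi> x \<otimes> \<phi> y) \<otimes> z \<otimes> (\<chi> x \<otimes> \<phi> y))"
      using x y z hom by (simp add: mult_twisted_group m_assoc inv_mult_group)
    \<comment> \<open>This swap is where the twists \<phi> and \<chi> have to be compatible with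
      each other.\<close>
    also have "\<dots> = x \<otimes> inv (\<chi> x) \<otimes> y \<otimes> (\<chi> x \<otimes> inv (\<phi> y \<otimes> \<chi> x) \<otimes> z \<otimes> (\<phi> y \<otimes> \<chi> x))"
      by (simp add: commuting_onD[OF comm(3) y x])
    also have "\<dots> = x \<otimes>\<^bsub>?C\<^esub> (y \<otimes>\<^bsub>?A\<^esub> z)"
      using x y z hom by (simp add: mult_twisted_group m_assoc inv_mult_group)
    finally show ?thesis ..
  qed
  then show ?thesis
    by unfold_locales simp_all
qed

section \<open>The maps psi_n of an abelian map\<close>

lemma psi_iter_0:
  "g \<in> carrier G \<Longrightarrow> psi_iter G \<psi> 0 g = \<one>"
  by (simp add: psi_iter_def map_add_def map_uminus_def)

text \<open>Put t = 1 - \<psi>. Then t^n(g) = g psi_n(g)^-1, and one more application of t gives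
  psi_{n+1}(g) = \<psi>(t^n(g)) psi_n(g). The homomorphism \<psi> splits the first factor.\<close>

lemma psi_iter_Suc:
  assumes hom: "\<psi> \<in> hom G G" and g: "g \<in> carrier G"
  shows "psi_iter G \<psi> (Suc n) g = \<psi> g \<otimes> inv (\<psi> (psi_iter G \<psi> n g)) \<otimes> psi_iter G \<psi> n g"
proof -
  let ?t = "map_minus G id \<psi>"
  have [simp]: "\<psi> z \<in> carrier G" if "z \<in> carrier G" for z
    using hom that by (rule hom_in_carrier)
  have "(?t ^^ n) g \<in> carrier G"
    by (induction n) (use g in \<open>auto simp: map_minus_def map_add_def map_uminus_def\<close>)
  then show ?thesis
    using g hom
    by (simp add: psi_iter_def map_minus_def map_add_def map_uminus_def
        inv_mult_group hom_mult hom_inv m_assoc)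
qed

lemma hom_mult_commuting:
  assumes hom: "\<phi> \<in> hom G G" "\<chi> \<in> hom G G" and comm: "commuting_on G \<phi> \<chi>"
  shows "(\<lambda>g. \<phi> g \<otimes> \<chi> g) \<in> hom G G"
proof (rule homI)
  fix x y assume x: "x \<in> carrier G" and y: "y \<in> carrier G"
  have [simp]: "\<phi> z \<in> carrier G" "\<chi> z \<in> carrier G" if "z \<in> carrier G" for z
    using hom that by (auto simp: hom_in_carrier)
  have "\<phi> (x \<otimes> y) \<otimes> \<chi> (x \<otimes> y) = \<phi> x \<otimes> (\<phi> y \<otimes> \<chi> x) \<otimes> \<chi> y"
    using hom x y by (simp add: hom_mult m_assoc)
  also have "\<dots> = \<phi> x \<otimes> \<chi> x \<otimes> (\<phi> y \<otimes> \<chi> y)"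
    using x y by (simp add: commuting_onD[OF comm y x] m_assoc)
  finally show "\<phi> (x \<otimes> y) \<otimes> \<chi> (x \<otimes> y) = \<phi> x \<otimes> \<chi> x \<otimes> (\<phi> y \<otimes> \<chi> y)" .
qed (use hom in \<open>simp add: hom_in_carrier\<close>)

context
  fixes \<psi>
  assumes abelian: "\<psi> \<in> abelian_maps G"
begin

lemma abelian_map_hom: "\<psi> \<in> hom G G"
  using abelian by (simp add: abelian_maps_def)

lemma abelian_map_image_commute:
  "\<lbrakk>a \<in> \<psi> ` carrier G; b \<in> \<psi> ` carrier G\<rbrakk> \<Longrightarrow> a \<otimes> b = b \<otimes> a"
  using abelian comm_groupE(4)[of "G\<lparr>carrier := \<psi> ` carrier G\<rparr>" a b]
  by (simp add: abelian_maps_def)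

lemma commuting_on_abelian_map_image:
  "\<lbrakk>\<phi> ` carrier G \<subseteq> \<psi> ` carrier G; \<chi> ` carrier G \<subseteq> \<psi> ` carrier G\<rbrakk> \<Longrightarrow> commuting_on G \<phi> \<chi>"
  unfolding commuting_on_def by (blast intro: abelian_map_image_commute)

text \<open>The image inclusion belongs to the induction: it provides the commutation that makes the
  next map a homomorphism.\<close>

lemma psi_iter_hom_image:
  "psi_iter G \<psi> n \<in> hom G G \<and> psi_iter G \<psi> n ` carrier G \<subseteq> \<psi> ` carrier G"
proof -
  interpret \<psi>: group_hom G G \<psi>
    by unfold_locales (rule abelian_map_hom)
  show ?thesis
  proof (induction n)
    case 0
    have "\<one> \<in> \<psi> ` carrier G" by (metis \<psi>.hom_one imageI one_closed)
    then show ?case by (auto simp: hom_def psi_iter_0)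
  next
    case (Suc n)
    let ?p = "psi_iter G \<psi> n" and ?S = "\<psi> ` carrier G"
    have S: "subgroup ?S G" by (rule \<psi>.img_is_subgroup)
    have p: "?p \<in> hom G G" and pS: "?p ` carrier G \<subseteq> ?S" using Suc by auto
    have [simp]: "?p z \<in> carrier G" if "z \<in> carrier G" for z
      using p that by (rule hom_in_carrier)
    \<comment> \<open>Written as a single value of \<psi>, \<open>?r g\<close> lies visibly in
      \<open>?S\<close>; the split form \<open>r_eq\<close> serves to show that \<open>?r\<close> is
      a homomorphism.\<close>
    let ?r = "\<lambda>g. \<psi> (g \<otimes> inv (?p g))"
    have r_eq: "?r g = \<psi> g \<otimes> inv (\<psi> (?p g))" if "g \<in> carrier G" for g
      using that by simp
    have r: "?r \<in> hom G G"
    proof -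
      have "(\<lambda>g. \<psi> g \<otimes> \<psi> (inv (?p g))) \<in> hom G G"
      proof (rule hom_mult_commuting)
        \<comment> \<open>Inversion reverses products, but the values of \<open>?p\<close>
          commute.\<close>
        show "(\<lambda>g. \<psi> (inv (?p g))) \<in> hom G G"
        proof (rule homI)
          fix x y assume x: "x \<in> carrier G" and y: "y \<in> carrier G"
          have "?p x \<otimes> ?p y = ?p y \<otimes> ?p x"
            using x y pS by (intro abelian_map_image_commute) auto
          then show "\<psi> (inv (?p (x \<otimes> y))) = \<psi> (inv (?p x)) \<otimes> \<psi> (inv (?p y))"
            using x y by (simp add: hom_mult[OF p] inv_mult_group del: \<psi>.hom_inv flip: \<psi>.hom_mult)
        qed simp
        show "commuting_on G \<psi> (\<lambda>g. \<psi> (inv (?p g)))"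
          by (rule commuting_on_abelian_map_image) (auto simp del: \<psi>.hom_inv)
      qed (rule abelian_map_hom)
      then show ?thesis by (rule hom_restrict) (auto simp: r_eq)
    qed
    \<comment> \<open>The deleted simp rules would split the value of \<psi> and obscure its
      membership in the image.\<close>
    have rS: "?r ` carrier G \<subseteq> ?S" by (auto simp del: \<psi>.hom_inv \<psi>.hom_mult)
    have "(\<lambda>g. ?r g \<otimes> ?p g) \<in> hom G G"
      using r p commuting_on_abelian_map_image[OF rS pS] by (rule hom_mult_commuting)
    moreover have step: "psi_iter G \<psi> (Suc n) g = ?r g \<otimes> ?p g" if "g \<in> carrier G" for g
      using that by (simp add: psi_iter_Suc[OF abelian_map_hom])
    ultimately have "psi_iter G \<psi> (Suc n) \<in> hom G G"
      by (auto intro: hom_restrict)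
    moreover have "psi_iter G \<psi> (Suc n) g \<in> ?S" if "g \<in> carrier G" for g
      unfolding step[OF that] using that rS pS by (intro subgroup.m_closed[OF S]) auto
    ultimately show ?case by blast
  qed
qed

end

end

theorem theorem4p7:
  fixes G :: "('a, 'b) monoid_scheme" and \<psi> :: "'a \<Rightarrow> 'a" and m n :: nat
  assumes "group G" and "finite (carrier G)" and "\<not> comm_group G"
    and "\<psi> \<in> abelian_maps G"
  shows "skew_left_brace (circ_group G \<psi> m) (circ_group G \<psi> n)"
proof -
  interpret group G by fact
  show ?thesis
    unfolding circ_group_eq_twisted_group
    \<comment> \<open>Both psi_m and psi_n have image inside the image of \<psi>, which yields all
      three commutation hypotheses.\<close>
    using psi_iter_hom_image[OF assms(4)] commuting_on_abelian_map_image[OF assms(4)]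
    by (intro skew_left_brace_twisted_group) auto
qed

end
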